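(* Let $R$ be a unital $*$-ring, let $a,b,c\in R$ and $k\in\mathbb{N}$. The following statements are equivalent: (i) $a$ is $(b,c)$-core-EP invertible with $k\in {\rm I}_{(b,c)}(a)$. (ii) $R=(ca)^{k+1}bR\oplus (((ca)^{k}c)^* )^0=R((ca)^{k}c)^*ca\oplus{}^0((ca)^{k}b)$. (iii) $R=(ca)^{k+1}bR+ (((ca)^{k}c)^* )^0=R((ca)^{k}c)^*ca+{}^0((ca)^{k}b)$.
   Context: $\mathbb{N}=\{0,1,2,\dots\}$. A unital $*$-ring is a ring $R$ with unity and an involution $*:R\to R$ satisfying $(a^* )^*=a$, $(ab)^*=b^*a^*$ and $(a+b)^*=a^*+b^*$. $a$ is $(b,c)$-core-EP invertible if there exist $x\in R$ and $k\in\mathbb{N}$ such that $cax(ca)^{k}c=(ca)^{k}c$, $xR=(ca)^{k}bR$ and $Rx=R((ca)^{k}c)^{*}$; ${\rm I}_{(b,c)}(a)$ is the set of all $k\in\mathbb{N}$ for which such an $x$ exists. For $u\in R$, $u^0=\{x\in R:ux=0\}$ is the right annihilator and ${}^0u=\{x\in R:xu=0\}$ is the left annihilator of $u$. *)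

theory Defs
  imports Main "HOL-Library.Set_Algebras"
begin

text \<open>
  The ring \<open>R\<close> is the whole carrier type, so \<open>UNIV\<close> stands for \<open>R\<close>. The class is built on
  \<^class>\<open>ring\<close> and \<^class>\<open>monoid_mult\<close> rather than \<^class>\<open>ring_1\<close>, because the latter
  requires \<open>0 \<noteq> 1\<close> and would exclude the zero ring.
\<close>

class unital_star_ring = ring + monoid_mult +
  fixes star :: "'a \<Rightarrow> 'a"
  assumes star_star: "star (star x) = x"
    and star_mult: "star (x * y) = star y * star x"
    and star_add: "star (x + y) = star x + star y"

definition principal_right :: "'a::{ring,monoid_mult} \<Rightarrow> 'a set" where
  "principal_right u = {u * r | r. r \<in> UNIV}"

definition principal_left :: "'a::{ring,monoid_mult} \<Rightarrow> 'a set" where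
  "principal_left u = {r * u | r. r \<in> UNIV}"

definition right_annihilator :: "'a::{ring,monoid_mult} \<Rightarrow> 'a set" where
  "right_annihilator u = {x. u * x = 0}"

definition left_annihilator :: "'a::{ring,monoid_mult} \<Rightarrow> 'a set" where
  "left_annihilator u = {x. x * u = 0}"

text \<open>
  \<open>A + B\<close> is the elementwise sum of sets from \<^theory>\<open>HOL-Library.Set_Algebras\<close>;
  \<open>is_direct_sum S A B\<close> expresses the internal decomposition \<open>S = A \<oplus> B\<close> of additive groups.
\<close>

definition is_direct_sum :: "'a::ring set \<Rightarrow> 'a set \<Rightarrow> 'a set \<Rightarrow> bool" where
  "is_direct_sum S A B \<longleftrightarrow> S = A + B \<and> A \<inter> B = {0}"

definition is_core_EP_inverse ::
  "'a::unital_star_ring \<Rightarrow> 'a \<Rightarrow> 'a \<Rightarrow> nat \<Rightarrow> 'a \<Rightarrow> bool" where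
  "is_core_EP_inverse b c a k x \<longleftrightarrow>
     c * a * x * (c * a) ^ k * c = (c * a) ^ k * c \<and>
     principal_right x = principal_right ((c * a) ^ k * b) \<and>
     principal_left x = principal_left (star ((c * a) ^ k * c))"

definition core_EP_invertible :: "'a::unital_star_ring \<Rightarrow> 'a \<Rightarrow> 'a \<Rightarrow> bool" where
  "core_EP_invertible b c a \<longleftrightarrow> (\<exists>x k. is_core_EP_inverse b c a k x)"

definition core_EP_indices :: "'a::unital_star_ring \<Rightarrow> 'a \<Rightarrow> 'a \<Rightarrow> nat set" where
  "core_EP_indices b c a = {k. \<exists>x. is_core_EP_inverse b c a k x}"

end

theory Submission
  imports Defs
begin

text \<open>
  Write \<open>p = ca\<close>, \<open>w = (ca)\<^sup>kc\<close>, \<open>q = (ca)\<^sup>kb\<close>. All three statements are equivalent to the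
  solvability of \<open>w\<^sup>* = w\<^sup>*pqt\<close> and \<open>q = zw\<^sup>*pq\<close>, and then \<open>x = qt = zw\<^sup>*\<close> is the required inverse:
  since \<open>pq = w(ab)\<close>, we have \<open>px = wu\<close> for some \<open>u\<close>, and \<open>w = (px)\<^sup>*w\<close> gives
  \<open>px = (px)\<^sup>*(px)\<close>, so \<open>px\<close> is self-adjoint and \<open>pxw = w\<close>. Conversely, \<open>pxw = w\<close> and
  \<open>x \<in> Rw\<^sup>*\<close> make \<open>px\<close> self-adjoint, whence \<open>w\<^sup>*px = w\<^sup>*\<close> and \<open>xpx = x\<close>.
\<close>

lemma principal_right_subset_iff:
  "principal_right u \<subseteq> principal_right v \<longleftrightarrow> (\<exists>t. u = v * t)"
proof
  assume "principal_right u \<subseteq> principal_right v"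
  moreover have "u * 1 \<in> principal_right u"
    unfolding principal_right_def by blast
  ultimately show "\<exists>t. u = v * t"
    unfolding principal_right_def by auto
qed (auto simp: principal_right_def mult.assoc)

lemma principal_left_subset_iff:
  "principal_left u \<subseteq> principal_left v \<longleftrightarrow> (\<exists>t. u = t * v)"
proof
  assume "principal_left u \<subseteq> principal_left v"
  moreover have "1 * u \<in> principal_left u"
    unfolding principal_left_def by blast
  ultimately show "\<exists>t. u = t * v"
    unfolding principal_left_def by auto
qed (auto simp: principal_left_def mult.assoc[symmetric])

text \<open>This turns a decomposition of the ring into a solvable equation. Writing
  \<open>1 = u * t + n\<close> and multiplying by \<open>s\<close> on the left kills
  \<open>n\<close>. Conversely, \<open>t\<close> splits every \<open>r\<close> into
  \<open>u * (t * r)\<close> and a remainder annihilated by \<open>s\<close>.\<close>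

lemma UNIV_eq_principal_right_plus_annihilator_iff:
  "UNIV = principal_right u + right_annihilator s \<longleftrightarrow> (\<exists>t. s = s * u * t)"
proof
  assume "UNIV = principal_right u + right_annihilator s"
  then have "1 \<in> principal_right u + right_annihilator s" by auto
  then obtain t n where "1 = u * t + n" "s * n = 0"
    by (auto simp: set_plus_def principal_right_def right_annihilator_def)
  then have "s = s * u * t"
    using distrib_left[of s "u * t" n] by (simp add: mult.assoc)
  then show "\<exists>t. s = s * u * t" ..
next
  assume "\<exists>t. s = s * u * t"
  then obtain t where t: "s = s * u * t" ..
  have "r \<in> principal_right u + right_annihilator s" for r
  proof -
    have "r = u * (t * r) + (r - u * (t * r))" by simp
    moreover have "s * (r - u * (t * r)) = 0"
      using arg_cong[OF t, of "\<lambda>v. v * r"] by (simp add: mult.assoc right_diff_distrib)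
    ultimately show ?thesis
      unfolding set_plus_def principal_right_def right_annihilator_def by blast
  qed
  then show "UNIV = principal_right u + right_annihilator s" by auto
qed

text \<open>Mirror image of the previous equivalence: \<open>1 = z * u + m\<close> is multiplied by
  \<open>q\<close> on the right.\<close>

lemma UNIV_eq_principal_left_plus_annihilator_iff:
  "UNIV = principal_left u + left_annihilator q \<longleftrightarrow> (\<exists>z. q = z * u * q)"
proof
  assume "UNIV = principal_left u + left_annihilator q"
  then have "1 \<in> principal_left u + left_annihilator q" by auto
  then obtain z m where "1 = z * u + m" "m * q = 0"
    by (auto simp: set_plus_def principal_left_def left_annihilator_def)
  then have "q = z * u * q"
    using distrib_right[of "z * u" m q] by simp
  then show "\<exists>z. q = z * u * q" ..
next
  assume "\<exists>z. q = z * u * q"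
  then obtain z where z: "q = z * u * q" ..
  have "r \<in> principal_left u + left_annihilator q" for r
  proof -
    have "r = (r * z) * u + (r - (r * z) * u)" by simp
    moreover have "(r - (r * z) * u) * q = 0"
      using arg_cong[OF z, of "\<lambda>v. r * v"] by (simp add: mult.assoc left_diff_distrib)
    ultimately show ?thesis
      unfolding set_plus_def principal_left_def left_annihilator_def by blast
  qed
  then show "UNIV = principal_left u + left_annihilator q" by auto
qed

lemma principal_right_Int_annihilator:
  assumes "\<And>r. s * u * r = 0 \<Longrightarrow> u * r = 0"
  shows "principal_right u \<inter> right_annihilator s = {0}"
  using assms unfolding principal_right_def right_annihilator_def
  by (auto simp: mult.assoc[symmetric] intro: exI[of _ 0])

lemma principal_left_Int_annihilator:
  assumes "\<And>r. r * u * q = 0 \<Longrightarrow> r * u = 0"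
  shows "principal_left u \<inter> left_annihilator q = {0}"
  using assms unfolding principal_left_def left_annihilator_def
  by (auto simp: mult.assoc[symmetric] intro: exI[of _ 0])

text \<open>The product \<open>star e * e\<close> is its own adjoint.\<close>

lemma self_adjoint_if_eq_star_mult:
  fixes e :: "'a::unital_star_ring"
  assumes "e = star e * e"
  shows "star e = e"
  using assms by (metis star_mult star_star)

lemma ex_core_EP_inverse:
  fixes a b c :: "'a::unital_star_ring" and k :: nat
  defines "p \<equiv> c * a" and "w \<equiv> (c * a) ^ k * c" and "q \<equiv> (c * a) ^ k * b"
  assumes t: "star w = star w * (p * q) * t" and z: "q = z * (star w * p) * q"
  shows "is_core_EP_inverse b c a k (q * t)"
proof -
  let ?x = "q * t"
  have "?x = z * (star w * (p * q) * t)"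
    by (subst z) (simp only: mult.assoc)
  then have x: "?x = z * star w"
    by (simp only: t[symmetric])
  have s: "star w = star w * (p * ?x)"
    using t unfolding mult.assoc .
  have w: "w = star (p * ?x) * w"
    using arg_cong[OF s, of star] unfolding star_mult[of "star w"] star_star .
  \<comment> \<open>Since \<open>c * a\<close> commutes with its powers, \<open>p * q\<close> lies
    in \<open>w\<close>R. Hence so does \<open>p * ?x\<close>, and left multiplication by
    \<open>star (p * ?x)\<close>, which fixes \<open>w\<close>, fixes \<open>p * ?x\<close>
    too.\<close>
  have "p * q = w * (a * b)"
    unfolding p_def q_def w_def
    using arg_cong[OF power_commutes[of "c * a" k], of "\<lambda>v. v * b"]
    by (simp only: mult.assoc)
  then have px: "p * ?x = w * (a * b * t)"
    by (simp add: mult.assoc[symmetric])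
  also have "\<dots> = star (p * ?x) * w * (a * b * t)"
    by (rule arg_cong[OF w])
  also have "\<dots> = star (p * ?x) * (p * ?x)"
    by (simp only: px mult.assoc)
  finally have "star (p * ?x) = p * ?x"
    by (rule self_adjoint_if_eq_star_mult)
  then have "p * ?x * w = w"
    using w[symmetric] by (simp only:)
  \<comment> \<open>With \<open>?x = z * star w\<close>, the equation for \<open>q\<close> gives the
    inclusion of \<open>q\<close>R in \<open>?x\<close>R; the reverse one is the definition of
    \<open>?x\<close>.\<close>
  moreover have "q = ?x * (p * q)"
    using z unfolding x mult.assoc .
  then have "principal_right ?x = principal_right q"
    using principal_right_subset_iff by (intro subset_antisym) blast+
  moreover have "star w = (star w * p) * ?x"
    using s unfolding mult.assoc .
  then have "principal_left ?x = principal_left (star w)"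
    using x principal_left_subset_iff by (intro subset_antisym) blast+
  ultimately show ?thesis
    unfolding is_core_EP_inverse_def p_def q_def w_def mult.assoc by blast
qed

lemma core_EP_inverse_direct_sums:
  fixes a b c :: "'a::unital_star_ring" and k :: nat
  defines "p \<equiv> c * a" and "w \<equiv> (c * a) ^ k * c" and "q \<equiv> (c * a) ^ k * b"
  assumes "is_core_EP_inverse b c a k x"
  shows "is_direct_sum UNIV (principal_right (p * q)) (right_annihilator (star w))"
    and "is_direct_sum UNIV (principal_left (star w * p)) (left_annihilator q)"
proof -
  have pxw: "p * x * w = w"
    and R: "principal_right x = principal_right q"
    and L: "principal_left x = principal_left (star w)"
    using assms unfolding is_core_EP_inverse_def by (simp_all add: mult.assoc)
  from R obtain t y where t: "x = q * t" and y: "q = x * y"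
    by (metis principal_right_subset_iff order_refl)
  from L obtain z where z: "x = z * star w"
    by (metis principal_left_subset_iff order_refl)
  \<comment> \<open>This puts \<open>star (p * x)\<close> in \<open>w\<close>R, where left
    multiplication by \<open>p * x\<close> is the identity, so \<open>e = star (p * x)\<close>
    satisfies \<open>e = star e * e\<close>.\<close>
  have "star (p * x) = w * (star z * star p)"
    by (simp add: z star_mult star_star mult.assoc)
  then have "star (p * x) = p * x * star (p * x)"
    using pxw by (simp add: mult.assoc[symmetric])
  then have sa: "star (p * x) = p * x"
    by (rule self_adjoint_if_eq_star_mult[of "star (p * x)", unfolded star_star, symmetric])
  have "star (p * x * w) = star w"
    by (simp only: pxw)
  then have s: "star w * p * x = star w"
    unfolding star_mult[of "p * x"] sa by (simp only: mult.assoc)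
  have "x * p * x = z * (star w * p * x)"
    by (subst z) (simp only: mult.assoc)
  then have xpx: "x * p * x = x"
    by (simp only: s z[symmetric])
  \<comment> \<open>As \<open>q\<close> is a right multiple of \<open>x\<close>, the identity
    \<open>x * p * x = x\<close> carries over to \<open>q\<close>.\<close>
  have "x * p * q = x * p * x * y"
    by (subst y) (simp only: mult.assoc)
  then have "x * p * q = q"
    by (simp only: xpx y[symmetric])
  then have q: "z * (star w * p) * q = q"
    by (simp only: z mult.assoc)
  have w: "star w * (p * q) * t = star w"
    using s unfolding t mult.assoc .

  have "p * q * r = 0" if "star w * (p * q) * r = 0" for r
  proof -
    \<comment> \<open>Expanding \<open>q\<close> as \<open>z * (star w * p) * q\<close> makes the
      vanishing factor appear.\<close>
    have "p * (z * (star w * p) * q) * r = p * z * (star w * (p * q) * r)"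
      by (simp only: mult.assoc)
    then show ?thesis
      by (simp add: q that)
  qed
  then have "principal_right (p * q) \<inter> right_annihilator (star w) = {0}"
    by (rule principal_right_Int_annihilator)
  then show "is_direct_sum UNIV (principal_right (p * q)) (right_annihilator (star w))"
    unfolding is_direct_sum_def UNIV_eq_principal_right_plus_annihilator_iff
    using w[symmetric] by blast

  have "r * (star w * p) = 0" if "r * (star w * p) * q = 0" for r
  proof -
    \<comment> \<open>Dually, here \<open>star w\<close> is expanded as
      \<open>star w * (p * q) * t\<close>.\<close>
    have "r * (star w * (p * q) * t * p) = r * (star w * p) * q * t * p"
      by (simp only: mult.assoc)
    then show ?thesis
      by (simp add: w that)
  qed
  then have "principal_left (star w * p) \<inter> left_annihilator q = {0}"
    by (rule principal_left_Int_annihilator)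
  then show "is_direct_sum UNIV (principal_left (star w * p)) (left_annihilator q)"
    unfolding is_direct_sum_def UNIV_eq_principal_left_plus_annihilator_iff
    using q[symmetric] by blast
qed

theorem theorem3p22:
  fixes a b c :: "'a::unital_star_ring" and k :: nat
  defines "stmt_i \<equiv> core_EP_invertible b c a \<and> k \<in> core_EP_indices b c a"
    and "stmt_ii \<equiv>
      is_direct_sum UNIV (principal_right ((c * a) ^ (k + 1) * b))
        (right_annihilator (star ((c * a) ^ k * c))) \<and>
      is_direct_sum UNIV (principal_left (star ((c * a) ^ k * c) * c * a))
        (left_annihilator ((c * a) ^ k * b))"
    and "stmt_iii \<equiv>
      UNIV = principal_right ((c * a) ^ (k + 1) * b) +
        right_annihilator (star ((c * a) ^ k * c)) \<and>
      UNIV = principal_left (star ((c * a) ^ k * c) * c * a) +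
        left_annihilator ((c * a) ^ k * b)"
  shows "(stmt_i \<longleftrightarrow> stmt_ii) \<and> (stmt_ii \<longleftrightarrow> stmt_iii)"
proof -
  let ?p = "c * a" and ?w = "(c * a) ^ k * c" and ?q = "(c * a) ^ k * b"
  have pq: "?p ^ (k + 1) * b = ?p * ?q" and sp: "star ?w * c * a = star ?w * ?p"
    by (simp_all add: mult.assoc)
  have "stmt_ii" if "stmt_i"
    using that core_EP_inverse_direct_sums
    unfolding stmt_i_def stmt_ii_def core_EP_indices_def pq sp by blast
  moreover have "stmt_iii" if "stmt_ii"
    using that unfolding stmt_ii_def stmt_iii_def is_direct_sum_def by blast
  moreover have "stmt_i" if "stmt_iii"
  proof -
    obtain t z where "star ?w = star ?w * (?p * ?q) * t" "?q = z * (star ?w * ?p) * ?q"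
      using \<open>stmt_iii\<close> unfolding stmt_iii_def pq sp
        UNIV_eq_principal_right_plus_annihilator_iff
        UNIV_eq_principal_left_plus_annihilator_iff by blast
    then have "is_core_EP_inverse b c a k (?q * t)"
      by (rule ex_core_EP_inverse)
    then show ?thesis
      unfolding stmt_i_def core_EP_invertible_def core_EP_indices_def by blast
  qed
  ultimately show ?thesis by blast
qed

end
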